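(* Let $F$ be a forest containing a vertex $v$ of degree $n\ge 2$ with neighbor set $N_F(v)=\{v_1,\dots,v_n\}$, where $v_1,\dots,v_{n-1}$ are leaves of $F$. Let $F'$ and $F''$ be the induced subforests $$F'=F\setminus\{v,v_1,\dots,v_{n-1}\},\qquad F''=F\setminus\{v,v_1,\dots,v_n\},$$ and set $r_1=(n-1)+M(F')$ and $r_2=M(F'')$. Then: (a) If $r_1<r_2$, then $M(F)=r_1$ and $c(F)=c(F')$. (b) If $r_2<r_1$, then $M(F)=r_2$ and $c(F)=-c(F'')$. (c) If $r_1=r_2=r$, then $M(F)\ge r$ and $[u^{r}]P_F(u-1)=c(F')-c(F'')$. In particular, $M(F)=r$ if and only if $c(F')\neq c(F'')$, while $M(F)\ge r+1$ if and only if $c(F')=c(F'')$.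
   Context: For a finite simple graph $G$, the independence polynomial is $P_G(x)=\sum_{i\ge0}g_ix^i\in\mathbb{Z}[x]$, where $g_i$ is the number of independent sets of $G$ of size $i$ (the graph with no vertices has $P_G=1$). Substituting $x=u-1$, $P_G(u-1)$ is a polynomial in $u$ (with coefficients viewed in $\mathbb{Q}$). $M(G)$ is the multiplicity of $x=-1$ as a root of $P_G(x)$, i.e. the order of vanishing of $P_G(u-1)$ at $u=0$; and $c(G)=[u^{M(G)}]P_G(u-1)\neq0$ is the corresponding lowest nonzero coefficient, where $[u^k]f$ denotes the coefficient of $u^k$ in $f$. For $U\subseteq V(F)$, $F\setminus U$ is the subgraph induced on $V(F)\setminus U$. *)

theory Defs
  imports "Graph_Theory.Graph_Theory" "HOL-Computational_Algebra.Computational_Algebra"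
begin

text \<open>
  Finite simple graphs are the locale \<open>graph\<close> of the Graph-Theory library: finite, loop-free,
  symmetric digraphs without parallel arcs, an undirected edge being a pair of opposite arcs.
  The graph without vertices is allowed.  The degree of a vertex is its \<open>out_degree\<close>.
\<close>

definition neighbors :: "('a, 'b) pre_digraph \<Rightarrow> 'a \<Rightarrow> 'a set" where
  "neighbors G v = {w. v \<rightarrow>\<^bsub>G\<^esub> w}"

definition leaf :: "('a, 'b) pre_digraph \<Rightarrow> 'a \<Rightarrow> bool" where
  "leaf G v \<longleftrightarrow> v \<in> verts G \<and> out_degree G v = 1"

text \<open>
  The library predicate \<open>forest\<close> refers to directed cycles, so that an edge traversed back and
  forth already counts as a cycle.  In a simple graph the undirected cycles are exactly the
  directed cycles of length at least 3.
\<close>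

definition undirected_forest :: "('a, 'b) pre_digraph \<Rightarrow> bool" where
  "undirected_forest G \<longleftrightarrow> graph G \<and> \<not> (\<exists>p. pre_digraph.cycle G p \<and> 3 \<le> length p)"

definition delete_verts :: "('a, 'b) pre_digraph \<Rightarrow> 'a set \<Rightarrow> ('a, 'b) pre_digraph" where
  "delete_verts G U = G \<restriction> (verts G - U)"

definition independent_set :: "('a, 'b) pre_digraph \<Rightarrow> 'a set \<Rightarrow> bool" where
  "independent_set G S \<longleftrightarrow> S \<subseteq> verts G \<and> (\<forall>u\<in>S. \<forall>w\<in>S. \<not> u \<rightarrow>\<^bsub>G\<^esub> w)"

definition num_indep :: "('a, 'b) pre_digraph \<Rightarrow> nat \<Rightarrow> nat" where
  "num_indep G i = card {S. independent_set G S \<and> card S = i}"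

definition indep_poly :: "('a, 'b) pre_digraph \<Rightarrow> int poly" where
  "indep_poly G = (\<Sum>i\<le>card (verts G). monom (int (num_indep G i)) i)"

text \<open>The polynomial \<open>P\<^sub>G(u - 1)\<close> in \<open>u\<close>, over the rationals.\<close>

definition shifted_indep_poly :: "('a, 'b) pre_digraph \<Rightarrow> rat poly" where
  "shifted_indep_poly G = map_poly of_int (indep_poly G) \<circ>\<^sub>p [:-1, 1:]"

text \<open>\<open>M(G)\<close> and \<open>c(G)\<close>.\<close>

definition mult_neg1 :: "('a, 'b) pre_digraph \<Rightarrow> nat" where
  "mult_neg1 G = order (-1) (indep_poly G)"

definition low_coeff :: "('a, 'b) pre_digraph \<Rightarrow> rat" where
  "low_coeff G = coeff (shifted_indep_poly G) (mult_neg1 G)"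

text \<open>
  \<open>M(G)\<close> is also the order of vanishing of \<open>P\<^sub>G(u - 1)\<close> at \<open>u = 0\<close>, and \<open>c(G)\<close> is its lowest
  nonzero coefficient.
\<close>

lemma indep_poly_nonzero:
  assumes "graph G"
  shows "indep_poly G \<noteq> 0"
proof -
  interpret graph G by fact
  have "{S. independent_set G S \<and> card S = 0} = {{}}"
    by (auto simp: independent_set_def dest: finite_subset[OF _ finite_verts])
  then have "coeff (indep_poly G) 0 = 1"
    by (simp add: indep_poly_def coeff_sum num_indep_def if_distrib sum.delta cong: if_cong)
  then show ?thesis by auto
qed

lemma order_shifted_indep_poly:
  assumes "graph G"
  shows "order 0 (shifted_indep_poly G) = mult_neg1 G" and "shifted_indep_poly G \<noteq> 0"
proof -
  let ?h = "map_poly (of_int :: int \<Rightarrow> rat)"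
  have h_mult: "?h (a * b) = ?h a * ?h b" for a b
    by (rule poly_eqI) (simp add: coeff_map_poly coeff_mult)
  have h_power: "?h (a ^ k) = ?h a ^ k" for a k
    by (induction k) (simp_all add: h_mult)
  have shift_power: "(a ^ k) \<circ>\<^sub>p b = (a \<circ>\<^sub>p b) ^ k" for a b :: "rat poly" and k
    by (induction k) (simp_all add: pcompose_mult pcompose_1)
  have poly_h: "poly (?h a) (of_int z) = of_int (poly a z)" for a z
    by (induction a) (simp_all add: map_poly_pCons)
  define p where "p = indep_poly G"
  define m where "m = order (-1) p"
  have "p \<noteq> 0" using indep_poly_nonzero[OF assms] by (simp add: p_def)
  from order_decomp[OF this, of "-1"] obtain q where
    q: "p = [:1, 1:] ^ m * q" "\<not> [:1, 1:] dvd q" unfolding m_def by auto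
  define q' where "q' = ?h q \<circ>\<^sub>p [:-1, 1:]"
  have "poly q (-1) \<noteq> 0" using q(2) by (simp add: poly_eq_0_iff_dvd)
  moreover have "poly q' 0 = of_int (poly q (-1))"
    using poly_h[of q "-1"] by (simp add: q'_def poly_pcompose)
  ultimately have q': "poly q' 0 \<noteq> 0" by simp
  have "?h [:1, 1:] \<circ>\<^sub>p [:-1, 1:] = [:0, 1:]"
    by (simp add: map_poly_pCons pcompose_pCons)
  then have eq: "shifted_indep_poly G = [:0, 1:] ^ m * q'"
    unfolding shifted_indep_poly_def p_def[symmetric] q'_def
    by (subst q(1)) (simp only: h_mult h_power pcompose_mult shift_power)
  show nz: "shifted_indep_poly G \<noteq> 0" using q' unfolding eq by auto
  have "order 0 ([:0, 1:] ^ m :: rat poly) = m"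
    using order_power_n_n[of "0 :: rat" m] by simp
  moreover have "order 0 (shifted_indep_poly G) = order 0 ([:0, 1:] ^ m :: rat poly) + order 0 q'"
    using nz unfolding eq by (rule order_mult)
  ultimately show "order 0 (shifted_indep_poly G) = mult_neg1 G"
    using order_0I[OF q'] by (simp add: mult_neg1_def m_def p_def)
qed

lemma low_coeff_nonzero:
  assumes "graph G"
  shows "low_coeff G \<noteq> 0" and "i < mult_neg1 G \<Longrightarrow> coeff (shifted_indep_poly G) i = 0"
proof -
  note nz = order_shifted_indep_poly(2)[OF assms]
  have *: "(\<forall>k<n. coeff (shifted_indep_poly G) k = 0) \<longleftrightarrow> n \<le> mult_neg1 G" for n
    using monom_1_dvd_iff[OF nz, of n] order_shifted_indep_poly(1)[OF assms]
    by (simp add: monom_1_dvd_iff')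
  show "i < mult_neg1 G \<Longrightarrow> coeff (shifted_indep_poly G) i = 0"
    using *[of "mult_neg1 G"] by simp
  show "low_coeff G \<noteq> 0"
    using *[of "mult_neg1 G"] *[of "Suc (mult_neg1 G)"]
    by (auto simp: low_coeff_def less_Suc_eq)
qed

lemma out_degree_eq_card_neighbors:
  assumes "graph G"
  shows "out_degree G v = card (neighbors G v)"
proof -
  interpret graph G by fact
  have "neighbors G v = head G ` out_arcs G v"
    by (auto simp: neighbors_def out_arcs_def arcs_ends_conv)
  moreover have "inj_on (head G) (out_arcs G v)"
    by (auto simp: inj_on_def arc_to_ends_def intro: no_multi_arcs)
  ultimately show ?thesis by (simp add: out_degree_def card_image)
qed

end

theory Submission
  imports Defs
begin

text \<open>
  Independent sets of \<open>F\<close> either avoid \<open>v\<close>, or consist of \<open>v\<close> and an independent set of \<open>F\<close> without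
  the closed neighbourhood of \<open>v\<close>; the latter graph is \<open>F''\<close>.  Once \<open>v\<close> is deleted, the leaves
  \<open>v\<^sub>1, \<dots>, v\<^sub>n\<^sub>-\<^sub>1\<close> are isolated, and each of them can be added freely to an independent set of \<open>F'\<close>.
  Hence \<open>P\<^sub>F(x) = (1 + x)\<^sup>n\<^sup>-\<^sup>1 P\<^bsub>F'\<^esub>(x) + x P\<^bsub>F''\<^esub>(x)\<close>, that is,
  \<open>P\<^sub>F(u - 1) = u\<^sup>n\<^sup>-\<^sup>1 P\<^bsub>F'\<^esub>(u - 1) + (u - 1) P\<^bsub>F''\<^esub>(u - 1)\<close>.
  The first summand starts with \<open>c(F') u\<^bsup>r\<^sub>1\<^esup>\<close> and the second one with \<open>- c(F'') u\<^bsup>r\<^sub>2\<^esup>\<close>, so that the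
  theorem compares the lowest terms of two polynomials in \<open>u\<close> that are added.

  The two graph-theoretic facts are \<open>indep_poly_vertex_deletion\<close> and
  \<open>indep_poly_delete_isolated\<close>; the identity in \<open>u\<close> is \<open>shifted_indep_poly_pendant_star\<close>.
\<close>

section \<open>Deleting vertices\<close>

lemma verts_delete_verts [simp]: "verts (delete_verts G U) = verts G - U"
  by (simp add: delete_verts_def)

lemma delete_verts_delete_verts:
  "delete_verts (delete_verts G A) B = delete_verts G (A \<union> B)"
  by (auto simp: delete_verts_def induce_subgraph_def)

lemma graph_delete_verts:
  assumes "graph G"
  shows "graph (delete_verts G U)"
proof -
  interpret graph G by fact
  have ind: "induced_subgraph (delete_verts G U) G"
    unfolding delete_verts_def by (rule induced_induce) blast
  interpret H: digraph "delete_verts G U"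
    by (rule digraphI_induced[OF ind])
  interpret H: sym_digraph "delete_verts G U"
    by (rule induced_graph_imp_graph[OF ind])
  show ?thesis by unfold_locales
qed

lemma dominates_delete_verts:
  "x \<rightarrow>\<^bsub>delete_verts G U\<^esub> y \<longleftrightarrow> x \<rightarrow>\<^bsub>G\<^esub> y \<and> x \<in> verts G - U \<and> y \<in> verts G - U"
  by (auto simp: delete_verts_def arcs_ends_conv)

lemma independent_set_delete_verts:
  "independent_set (delete_verts G U) S \<longleftrightarrow> independent_set G S \<and> S \<inter> U = {}"
  by (auto simp: independent_set_def dominates_delete_verts)

section \<open>The independence polynomial as a sum over independent sets\<close>

lemma finite_independent_sets:
  assumes "graph G"
  shows "finite {S. independent_set G S}"
proof -
  interpret graph G by fact
  show ?thesis
    by (rule finite_subset[of _ "Pow (verts G)"]) (auto simp: independent_set_def)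
qed

lemma indep_poly_eq_sum_independent_sets:
  assumes "graph G"
  shows "indep_poly G = (\<Sum>S | independent_set G S. monom 1 (card S))"
proof -
  interpret graph G by fact
  let ?I = "{S. independent_set G S}"
  have "(\<Sum>S\<in>?I. monom 1 (card S) :: int poly)
      = (\<Sum>i\<le>card (verts G). \<Sum>S\<in>{S \<in> ?I. card S = i}. monom 1 (card S))"
    by (rule sum.group[symmetric])
       (auto simp: finite_independent_sets[OF assms] independent_set_def intro: card_mono)
  also have "\<dots> = indep_poly G"
    unfolding indep_poly_def num_indep_def
    by (intro sum.cong refl) (simp flip: monom_0 add: of_nat_monom mult_monom)
  finally show ?thesis ..
qed

text \<open>
  An independent set containing \<open>v\<close> is \<open>v\<close> together with an independent set that avoids \<open>v\<close> and its
  neighbours; removing \<open>v\<close> lowers the size by one, whence the factor \<open>x\<close>.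
\<close>

lemma indep_poly_vertex_deletion:
  assumes "graph G" and v: "v \<in> verts G"
  shows "indep_poly G = indep_poly (delete_verts G {v})
    + [:0, 1:] * indep_poly (delete_verts G ({v} \<union> neighbors G v))"
proof -
  interpret graph G by fact
  let ?A = "{S. independent_set (delete_verts G {v}) S}"
  let ?B = "{S. independent_set (delete_verts G ({v} \<union> neighbors G v)) S}"
  have fin: "finite ?A" "finite ?B"
    using finite_independent_sets graph_delete_verts[OF \<open>graph G\<close>] by blast+
  have sym: "x \<rightarrow>\<^bsub>G\<^esub> y \<Longrightarrow> y \<rightarrow>\<^bsub>G\<^esub> x" for x y
    by (rule arcs_ends_symmetric[OF sym_arcs])
  have irrefl: "\<not> v \<rightarrow>\<^bsub>G\<^esub> v"
    using adj_not_same by blast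
  have split: "{S. independent_set G S} = ?A \<union> insert v ` ?B"
  proof (intro equalityI subsetI)
    fix S assume S: "S \<in> {S. independent_set G S}"
    show "S \<in> ?A \<union> insert v ` ?B"
    proof (cases "v \<in> S")
      case True
      then have "S - {v} \<in> ?B" and "S = insert v (S - {v})"
        using S by (auto simp: independent_set_def neighbors_def dominates_delete_verts)
      then show ?thesis by blast
    next
      case False
      then show ?thesis using S by (auto simp: independent_set_delete_verts)
    qed
  next
    fix S assume "S \<in> ?A \<union> insert v ` ?B"
    then show "S \<in> {S. independent_set G S}"
      using v irrefl unfolding independent_set_delete_verts
      by (auto simp: independent_set_def neighbors_def dest: sym)
  qed
  have disj: "?A \<inter> insert v ` ?B = {}"
    by (auto simp: independent_set_delete_verts)
  have notin: "v \<notin> S" if "S \<in> ?B" for S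
    using that by (auto simp: independent_set_delete_verts)
  have "indep_poly G = (\<Sum>S\<in>?A. monom 1 (card S)) + (\<Sum>S\<in>insert v ` ?B. monom 1 (card S))"
    unfolding indep_poly_eq_sum_independent_sets[OF \<open>graph G\<close>] split
    using fin disj by (intro sum.union_disjoint) auto
  also have "(\<Sum>S\<in>insert v ` ?B. monom 1 (card S)) = (\<Sum>S\<in>?B. monom (1::int) (card (insert v S)))"
    using notin by (intro sum.reindex_cong[OF _ refl refl] inj_onI) (metis Diff_insert_absorb)
  also have "\<dots> = (\<Sum>S\<in>?B. [:0, 1:] * monom 1 (card S))"
  proof (rule sum.cong[OF refl])
    fix S assume S: "S \<in> ?B"
    then have "finite S"
      using finite_subset[OF _ finite_verts] by (auto simp: independent_set_def)
    then show "monom (1::int) (card (insert v S)) = [:0, 1:] * monom 1 (card S)"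
      using notin[OF S] by (simp add: monom_Suc)
  qed
  finally show ?thesis
    by (simp add: indep_poly_eq_sum_independent_sets graph_delete_verts[OF \<open>graph G\<close>]
        sum_distrib_left)
qed

text \<open>At an isolated vertex the two deletions coincide, which produces the factor \<open>1 + x\<close>.\<close>

lemma indep_poly_delete_isolated:
  assumes "graph G" and "finite L" and "L \<subseteq> verts G" and "\<And>x. x \<in> L \<Longrightarrow> neighbors G x = {}"
  shows "indep_poly G = [:1, 1:] ^ card L * indep_poly (delete_verts G L)"
  using assms(2,1,3,4)
proof (induction L arbitrary: G rule: finite_induct)
  case empty
  then interpret graph G by simp
  have "arcs (delete_verts G {}) = arcs G"
    by (auto simp: delete_verts_def)
  then have "delete_verts G {} = G"
    by (intro pre_digraph.equality) (simp_all add: delete_verts_def)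
  then show ?case by simp
next
  case (insert x L)
  let ?H = "delete_verts G {x}"
  have "indep_poly G = [:1, 1:] * indep_poly ?H"
    using indep_poly_vertex_deletion[of G x] insert.prems by simp
  also have "indep_poly ?H = [:1, 1:] ^ card L * indep_poly (delete_verts ?H L)"
    using insert.prems insert.hyps
    by (intro insert.IH graph_delete_verts) (auto simp: neighbors_def dominates_delete_verts)
  finally show ?case
    by (simp only: card_insert_disjoint[OF insert.hyps] power_Suc mult.assoc
        delete_verts_delete_verts insert_is_Un[of x L, symmetric])
qed

section \<open>The recursion at a vertex with pendant leaves\<close>

lemma neighbors_leaf:
  assumes "graph G" and "leaf G x" and "v \<rightarrow>\<^bsub>G\<^esub> x"
  shows "neighbors G x = {v}"
proof -
  interpret graph G by fact
  have "v \<in> neighbors G x"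
    using arcs_ends_symmetric[OF sym_arcs assms(3)] by (simp add: neighbors_def)
  moreover have "card (neighbors G x) = 1"
    using assms(2) out_degree_eq_card_neighbors[OF assms(1)] by (simp add: leaf_def)
  ultimately show ?thesis by (auto simp: card_1_singleton_iff)
qed

lemma indep_poly_pendant_star:
  assumes "graph G" and "v \<in> verts G" and "L \<subseteq> neighbors G v" and "\<And>x. x \<in> L \<Longrightarrow> leaf G x"
  shows "indep_poly G = [:1, 1:] ^ card L * indep_poly (delete_verts G ({v} \<union> L))
    + [:0, 1:] * indep_poly (delete_verts G ({v} \<union> neighbors G v))"
proof -
  interpret graph G by fact
  let ?H = "delete_verts G {v}"
  have L: "x \<in> verts G" "x \<noteq> v" "neighbors G x = {v}" if "x \<in> L" for x
    using that assms(3,4) neighbors_leaf[OF assms(1), of x v] adj_not_same[of v]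
    by (auto simp: leaf_def neighbors_def)
  have "finite L"
    using L(1) by (intro finite_subset[OF _ finite_verts]) blast
  moreover have "neighbors ?H x = {}" if "x \<in> L" for x
    using L(3)[OF that] by (auto simp: neighbors_def dominates_delete_verts)
  ultimately have "indep_poly ?H = [:1, 1:] ^ card L * indep_poly (delete_verts ?H L)"
    using L(1,2) by (intro indep_poly_delete_isolated graph_delete_verts assms(1)) auto
  then show ?thesis
    using indep_poly_vertex_deletion[OF assms(1,2)] by (simp add: delete_verts_delete_verts)
qed

text \<open>
  Substituting \<open>x = u - 1\<close> is a ring homomorphism that sends \<open>1 + x\<close> to \<open>u\<close>, so the powers of
  \<open>1 + x\<close> become shifts of the coefficient sequence.
\<close>

lemma shifted_indep_poly_pendant_star:
  assumes "graph G" and "v \<in> verts G" and "L \<subseteq> neighbors G v" and "\<And>x. x \<in> L \<Longrightarrow> leaf G x"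
  shows "shifted_indep_poly G = monom 1 (card L) * shifted_indep_poly (delete_verts G ({v} \<union> L))
    + [:-1, 1:] * shifted_indep_poly (delete_verts G ({v} \<union> neighbors G v))"
proof -
  let ?s = "\<lambda>p :: int poly. map_poly (of_int :: int \<Rightarrow> rat) p \<circ>\<^sub>p [:-1, 1:]"
  have s_add: "?s (p + q) = ?s p + ?s q" for p q
  proof -
    have "map_poly (of_int :: int \<Rightarrow> rat) (p + q) = map_poly of_int p + map_poly of_int q"
      by (rule poly_eqI) (simp add: coeff_map_poly)
    then show ?thesis by (simp add: pcompose_add)
  qed
  have s_mult: "?s (p * q) = ?s p * ?s q" for p q
  proof -
    have "map_poly (of_int :: int \<Rightarrow> rat) (p * q) = map_poly of_int p * map_poly of_int q"
      by (rule poly_eqI) (simp add: coeff_map_poly coeff_mult)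
    then show ?thesis by (simp add: pcompose_mult)
  qed
  have s_linear: "?s [:0, 1:] = [:-1, 1:]" "?s [:1, 1:] = [:0, 1:]"
    by (simp_all add: map_poly_pCons pcompose_pCons)
  have s_power: "?s ([:1, 1:] ^ k) = monom 1 k" for k
  proof (induction k)
    case 0
    show ?case by (simp add: pcompose_1)
  next
    case (Suc k)
    then show ?case by (simp only: power_Suc s_mult s_linear) (simp add: monom_Suc)
  qed
  show ?thesis
    unfolding shifted_indep_poly_def
    by (subst indep_poly_pendant_star[OF assms(1-3)])
       (simp_all only: assms(4) s_add s_mult s_power s_linear)
qed

section \<open>Comparing lowest terms\<close>

lemma mult_neg1_ge_iff:
  assumes "graph G"
  shows "m \<le> mult_neg1 G \<longleftrightarrow> (\<forall>k<m. coeff (shifted_indep_poly G) k = 0)"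
proof
  assume "m \<le> mult_neg1 G"
  then show "\<forall>k<m. coeff (shifted_indep_poly G) k = 0"
    using low_coeff_nonzero(2)[OF assms] by simp
next
  assume "\<forall>k<m. coeff (shifted_indep_poly G) k = 0"
  then show "m \<le> mult_neg1 G"
    using low_coeff_nonzero(1)[OF assms] by (force simp: low_coeff_def not_le[symmetric])
qed

lemma mult_neg1_eqI:
  assumes "graph G" and "\<And>k. k < m \<Longrightarrow> coeff (shifted_indep_poly G) k = 0"
    and "coeff (shifted_indep_poly G) m \<noteq> 0"
  shows "mult_neg1 G = m"
proof (rule order_antisym)
  show "mult_neg1 G \<le> m"
    using low_coeff_nonzero(2)[OF assms(1), of m] assms(3) by (meson not_le)
  show "m \<le> mult_neg1 G"
    using assms(2) by (simp add: mult_neg1_ge_iff[OF assms(1)])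
qed

theorem theorem6p6:
  fixes F F' F'' :: "('a, 'b) pre_digraph"
    and v :: 'a and w :: "nat \<Rightarrow> 'a" and n r1 r2 :: nat
  assumes "undirected_forest F"
    and "v \<in> verts F"
    and "n \<ge> 2"
    and "out_degree F v = n"
    and "bij_betw w {1..n} (neighbors F v)"
    and "\<forall>i\<in>{1..n - 1}. leaf F (w i)"
    and "F' = delete_verts F ({v} \<union> w ` {1..n - 1})"
    and "F'' = delete_verts F ({v} \<union> w ` {1..n})"
    and "r1 = (n - 1) + mult_neg1 F'"
    and "r2 = mult_neg1 F''"
  shows "(r1 < r2 \<longrightarrow> mult_neg1 F = r1 \<and> low_coeff F = low_coeff F') \<and>
    (r2 < r1 \<longrightarrow> mult_neg1 F = r2 \<and> low_coeff F = - low_coeff F'') \<and>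
    (\<forall>r. r1 = r \<and> r2 = r \<longrightarrow>
       mult_neg1 F \<ge> r \<and>
       coeff (shifted_indep_poly F) r = low_coeff F' - low_coeff F'' \<and>
       (mult_neg1 F = r \<longleftrightarrow> low_coeff F' \<noteq> low_coeff F'') \<and>
       (mult_neg1 F \<ge> r + 1 \<longleftrightarrow> low_coeff F' = low_coeff F''))"
proof -
  have F: "graph F"
    using assms(1) by (simp add: undirected_forest_def)
  then have F': "graph F'" and F'': "graph F''"
    unfolding assms(7,8) by (simp_all add: graph_delete_verts)
  let ?L = "w ` {1..n - 1}"
  have w: "inj_on w {1..n}" "w ` {1..n} = neighbors F v"
    using assms(5) by (auto simp: bij_betw_def)
  have L: "?L \<subseteq> neighbors F v"
    unfolding w(2)[symmetric] by auto
  have "inj_on w {1..n - 1}"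
    by (rule inj_on_subset[OF w(1)]) auto
  then have card_L: "card ?L = n - 1"
    by (simp add: card_image)
  define A where "A = monom 1 (n - 1) * shifted_indep_poly F'"
  define B where "B = [:-1, 1:] * shifted_indep_poly F''"
  have eq: "shifted_indep_poly F = A + B"
    unfolding A_def B_def assms(7,8) w(2)
    by (subst shifted_indep_poly_pendant_star[OF F assms(2) L]) (use assms(6) card_L in auto)
  have A_low: "coeff A k = 0" if "k < r1" for k
    using that low_coeff_nonzero(2)[OF F'] by (auto simp: A_def coeff_monom_mult assms(9))
  have A_lead: "coeff A r1 = low_coeff F'"
    by (simp add: A_def coeff_monom_mult assms(9) low_coeff_def)
  have B_coeff: "coeff B k = (if k = 0 then 0 else coeff (shifted_indep_poly F'') (k - 1))
      - coeff (shifted_indep_poly F'') k" for k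
    by (cases k) (simp_all add: B_def)
  have B_low: "coeff B k = 0" if "k < r2" for k
    using that low_coeff_nonzero(2)[OF F''] by (simp add: B_coeff assms(10))
  \<comment> \<open>The term \<open>u P\<^bsub>F''\<^esub>\<close> starts one degree later, so only \<open>- P\<^bsub>F''\<^esub>\<close> reaches the lowest degree.\<close>
  have B_lead: "coeff B r2 = - low_coeff F''"
    using low_coeff_nonzero(2)[OF F'', of "r2 - 1"]
    by (auto simp: B_coeff assms(10) low_coeff_def)
  show ?thesis
  proof (intro conjI impI allI)
    assume "r1 < r2"
    then have *: "coeff (shifted_indep_poly F) r1 = low_coeff F'"
      by (simp add: eq A_lead B_low)
    show "mult_neg1 F = r1"
      using \<open>r1 < r2\<close> low_coeff_nonzero(1)[OF F'] *
      by (intro mult_neg1_eqI[OF F]) (simp_all add: eq A_low B_low)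
    with * show "low_coeff F = low_coeff F'"
      by (simp add: low_coeff_def)
  next
    assume "r2 < r1"
    then have *: "coeff (shifted_indep_poly F) r2 = - low_coeff F''"
      by (simp add: eq A_low B_lead)
    show "mult_neg1 F = r2"
      using \<open>r2 < r1\<close> low_coeff_nonzero(1)[OF F''] *
      by (intro mult_neg1_eqI[OF F]) (simp_all add: eq A_low B_low)
    with * show "low_coeff F = - low_coeff F''"
      by (simp add: low_coeff_def)
  next
    fix r assume r: "r1 = r \<and> r2 = r"
    have zero: "coeff (shifted_indep_poly F) k = 0" if "k < r" for k
      using that r by (simp add: eq A_low B_low)
    show lead: "coeff (shifted_indep_poly F) r = low_coeff F' - low_coeff F''"
      using A_lead B_lead r by (simp add: eq)
    show ge: "mult_neg1 F \<ge> r"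
      using zero by (simp add: mult_neg1_ge_iff[OF F])
    show ge1: "mult_neg1 F \<ge> r + 1 \<longleftrightarrow> low_coeff F' = low_coeff F''"
      using zero lead by (auto simp: mult_neg1_ge_iff[OF F] less_Suc_eq)
    show "mult_neg1 F = r \<longleftrightarrow> low_coeff F' \<noteq> low_coeff F''"
      using ge ge1 by linarith
  qed
qed

end
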